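(* Let $f,g:\mathbb{R}_+\to\mathbb{R}_+$ be functions of class $C^\infty$ with nowhere vanishing first derivatives, let $h:\mathbb{R}_+^2\to\mathbb{R}_+$, $h(x,y)=f(x)g(y)$, and let $M^2$ be the product production surface $r(x,y)=(x,y,f(x)g(y))$ in the isotropic space $\mathbb{I}^3$. Suppose that $M^2$ has constant isotropic mean curvature $H_0$, i.e. $h_{xx}+h_{yy}=H_0$ on $\mathbb{R}_+^2$. Then either (A) $h(x,y)=\frac{H_0}{g_0}x^2+d_1x+d_2$ (or $h(x,y)=\frac{H_0}{f_0}y^2+d_1y+d_2$) for some $f_0,g_0\in\mathbb{R}\setminus\{0\}$ and $d_1,d_2\in\mathbb{R}$; or (B) $M^2$ is isotropic minimal, i.e. $H_0=0$, and, up to translations of $x$ and $y$, $h$ is the Cobb-Douglas production function $h(x,y)=Axy$ with $A>0$; that is, there are real constants $A>0$, $d_1,d_2$ such that $h(x,y)=A(x+d_1)(y+d_2)$ for all $x,y>0$.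
   Context: $\mathbb{R}_+=(0,\infty)$. The isotropic 3-space $\mathbb{I}^3$ is $\mathbb{R}^3$ with the degenerate metric $dx_1^2+dx_2^2$. For a graph surface $(x,y)\mapsto(x,y,h(x,y))$ in $\mathbb{I}^3$ the isotropic mean curvature is $H=h_{xx}+h_{yy}$ (no factor $\tfrac12$), and the surface is called isotropic minimal if $H=0$. Production functions are positive, of class $C^\infty$, with nonvanishing first derivatives; a product production function of 2 variables is one of the form $h(x,y)=f(x)g(y)$. *)

theory Defs
  imports "HOL-Analysis.Analysis"
begin

(* Meant for open S: the derivatives are two-sided, and only the values of f near S matter. *)
definition smooth_on_reals :: "real set \<Rightarrow> (real \<Rightarrow> real) \<Rightarrow> bool" where
  "smooth_on_reals S f \<longleftrightarrow> (\<forall>k::nat. \<forall>x\<in>S. (deriv ^^ k) f differentiable (at x))"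

(* Functions from (0,\<infinity>) to (0,\<infinity>) are total functions on the reals whose values outside
   (0,\<infinity>) are irrelevant. *)
definition production_function :: "(real \<Rightarrow> real) \<Rightarrow> bool" where
  "production_function f \<longleftrightarrow>
     (\<forall>x>0. f x > 0) \<and> smooth_on_reals {0<..} f \<and> (\<forall>x>0. deriv f x \<noteq> 0)"

definition partial_xx :: "(real \<Rightarrow> real \<Rightarrow> real) \<Rightarrow> real \<Rightarrow> real \<Rightarrow> real" where
  "partial_xx h x y = deriv (\<lambda>s. deriv (\<lambda>t. h t y) s) x"

definition partial_yy :: "(real \<Rightarrow> real \<Rightarrow> real) \<Rightarrow> real \<Rightarrow> real \<Rightarrow> real" where
  "partial_yy h x y = deriv (\<lambda>s. deriv (\<lambda>t. h x t) s) y"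

(* Mean curvature of the graph surface (x,y) \<mapsto> (x, y, h x y) in the isotropic 3-space, i.e.
   R^3 with the degenerate metric dx1^2 + dx2^2; normalised without the factor 1/2. *)
definition isotropic_mean_curvature :: "(real \<Rightarrow> real \<Rightarrow> real) \<Rightarrow> real \<Rightarrow> real \<Rightarrow> real" where
  "isotropic_mean_curvature h x y = partial_xx h x y + partial_yy h x y"

(* The graph is taken over the open quadrant x, y > 0. *)
definition isotropic_minimal :: "(real \<Rightarrow> real \<Rightarrow> real) \<Rightarrow> bool" where
  "isotropic_minimal h \<longleftrightarrow> (\<forall>x>0. \<forall>y>0. isotropic_mean_curvature h x y = 0)"

end

theory Submission
  imports Defs
begin

text \<open>
  The idea is separation of variables. For \<open>h x y = f x * g y\<close> the curvature condition reads
  \<open>f'' x * g y + f x * g'' y = H\<^sub>0\<close>. Differentiating in \<open>x\<close> at one point where \<open>f' \<noteq> 0\<close> removes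
  \<open>H\<^sub>0\<close> and shows that \<open>g''\<close> is a constant multiple of \<open>g\<close> (lemma
  \<open>separation_constant_exists\<close>); by symmetry \<open>f'' = k * f\<close> and \<open>g'' = l * g\<close>. Now
  \<open>(k + l) * f x * g y = H\<^sub>0\<close>, and since \<open>f\<close> is not constant, \<open>l = - k\<close> and \<open>H\<^sub>0 = 0\<close>.

  If \<open>k \<noteq> 0\<close>, one of the two factors solves the harmonic oscillator equation \<open>u'' = - c * u\<close> with
  \<open>c > 0\<close>. Such a \<open>u\<close> is antiperiodic with antiperiod \<open>\<pi> / sqrt c\<close> (lemma
  \<open>harmonic_oscillator_antiperiodic\<close>), so it cannot be positive on a half-line. Hence \<open>k = 0\<close>, both
  factors are affine, and positivity near infinity makes both slopes positive.

  Thus it is always the second, minimal alternative of the theorem that occurs: in the first one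
  \<open>h\<close> would depend on a single variable, against the nonvanishing derivatives.
\<close>

lemma production_function_derivatives:
  assumes "production_function f" "x > 0"
  shows "f x > 0"
    and "deriv f x \<noteq> 0"
    and "(f has_real_derivative deriv f x) (at x)"
    and "(deriv f has_real_derivative deriv (deriv f) x) (at x)"
    and "(deriv (deriv f) has_real_derivative deriv (deriv (deriv f)) x) (at x)"
proof -
  have diff: "(deriv ^^ k) f differentiable (at x)" for k
    using assms unfolding production_function_def smooth_on_reals_def by auto
  show "f x > 0" "deriv f x \<noteq> 0"
    using assms unfolding production_function_def by auto
  show "(f has_real_derivative deriv f x) (at x)"
    using diff[of 0] by (simp add: DERIV_deriv_iff_real_differentiable)
  show "(deriv f has_real_derivative deriv (deriv f) x) (at x)"
    using diff[of 1] by (simp add: DERIV_deriv_iff_real_differentiable)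
  show "(deriv (deriv f) has_real_derivative deriv (deriv (deriv f)) x) (at x)"
    using diff[of 2] by (simp add: DERIV_deriv_iff_real_differentiable numeral_2_eq_2)
qed

lemma eventually_pos_nhds:
  fixes x :: real
  assumes "x > 0"
  shows "eventually (\<lambda>t. t > 0) (nhds x)"
  using assms by (intro eventually_nhds_in_open[of "{0<..}", simplified]) auto

lemma DERIV_zero_of_const_on_pos:
  fixes u :: "real \<Rightarrow> real"
  assumes "a > 0" "\<And>x. x > 0 \<Longrightarrow> u x = c"
  shows "(u has_real_derivative 0) (at a)"
  by (rule has_field_derivative_transform_within_open[where f = "\<lambda>_. c" and S = "{0<..}"])
    (use assms in auto)

lemma second_deriv_scaled:
  fixes u v :: "real \<Rightarrow> real"
  assumes "production_function u" "\<And>t. t > 0 \<Longrightarrow> v t = u t * c" "x > 0"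
  shows "deriv (\<lambda>s. deriv v s) x = deriv (deriv u) x * c"
proof -
  have first: "deriv v s = deriv u s * c" if "s > 0" for s
  proof -
    have "deriv v s = deriv (\<lambda>t. u t * c) s"
      using eventually_pos_nhds[OF that] assms(2)
      by (intro deriv_cong_ev) (auto elim: eventually_mono)
    also have "\<dots> = deriv u s * c"
      by (intro DERIV_imp_deriv DERIV_cmult_right production_function_derivatives(3) assms(1) that)
    finally show ?thesis .
  qed
  have "deriv (\<lambda>s. deriv v s) x = deriv (\<lambda>s. deriv u s * c) x"
    using eventually_pos_nhds[OF assms(3)] first
    by (intro deriv_cong_ev) (auto elim: eventually_mono)
  also have "\<dots> = deriv (deriv u) x * c"
    by (intro DERIV_imp_deriv DERIV_cmult_right production_function_derivatives(4) assms(1,3))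
  finally show ?thesis .
qed

lemma isotropic_mean_curvature_product:
  assumes "production_function f" "production_function g"
    and "\<forall>x>0. \<forall>y>0. h x y = f x * g y" "x > 0" "y > 0"
  shows "isotropic_mean_curvature h x y = deriv (deriv f) x * g y + f x * deriv (deriv g) y"
proof -
  have "partial_xx h x y = deriv (deriv f) x * g y"
    unfolding partial_xx_def using assms by (intro second_deriv_scaled) auto
  moreover have "partial_yy h x y = deriv (deriv g) y * f x"
    unfolding partial_yy_def using assms by (intro second_deriv_scaled) (auto simp: mult.commute)
  ultimately show ?thesis
    unfolding isotropic_mean_curvature_def by (simp add: mult.commute)
qed

text \<open>
  At a single point \<open>a\<close> with \<open>f' a \<noteq> 0\<close>, the \<open>x\<close>-derivative of the separated equation is
  \<open>f''' a * g y + f' a * g'' y = 0\<close>, a linear relation between \<open>g\<close> and \<open>g''\<close> whose coefficients do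
  not depend on \<open>y\<close>.
\<close>

lemma separation_constant_exists:
  fixes f f2 g g2 :: "real \<Rightarrow> real"
  assumes eq: "\<And>x y. x > 0 \<Longrightarrow> y > 0 \<Longrightarrow> f2 x * g y + f x * g2 y = H"
    and "a > 0" "(f has_real_derivative p) (at a)" "(f2 has_real_derivative q) (at a)" "p \<noteq> 0"
  shows "\<exists>k. \<forall>y>0. g2 y = k * g y"
proof (intro exI allI impI)
  fix y :: real assume y: "y > 0"
  have "((\<lambda>x. f2 x * g y + f x * g2 y) has_real_derivative q * g y + p * g2 y) (at a)"
    using assms(3,4) by (auto intro!: derivative_eq_intros)
  moreover have "((\<lambda>x. f2 x * g y + f x * g2 y) has_real_derivative 0) (at a)"
    by (rule DERIV_zero_of_const_on_pos[OF \<open>a > 0\<close> eq[OF _ y]])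
  ultimately have "q * g y + p * g2 y = 0"
    by (rule DERIV_unique)
  then show "g2 y = (- q / p) * g y"
    using \<open>p \<noteq> 0\<close> by (simp add: field_simps)
qed

text \<open>
  The Wronskian of \<open>u\<close> and \<open>sin (w * (t - a))\<close> is constant, because both functions solve the same
  equation. At \<open>t = a\<close> it equals \<open>- w * u a\<close>, and half a period later it equals
  \<open>w * u (a + pi / w)\<close>.
\<close>

lemma harmonic_oscillator_antiperiodic:
  fixes u u1 :: "real \<Rightarrow> real"
  assumes "w > 0"
    and u: "\<And>t. t \<ge> a \<Longrightarrow> (u has_real_derivative u1 t) (at t)"
    and u1: "\<And>t. t \<ge> a \<Longrightarrow> (u1 has_real_derivative - w\<^sup>2 * u t) (at t)"
  shows "u (a + pi / w) = - u a"
proof -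
  define W where "W t = u1 t * sin (w * (t - a)) - w * u t * cos (w * (t - a))" for t
  have W': "(W has_real_derivative 0) (at t)" if "t \<ge> a" for t
    unfolding W_def using that
    by (auto intro!: derivative_eq_intros u u1 simp: algebra_simps power2_eq_square)
  have "W (a + pi / w) = W a"
  proof (rule DERIV_isconst_end[where f = W])
    show "a < a + pi / w" using \<open>w > 0\<close> by simp
    show "continuous_on {a..a + pi / w} W"
      using W' by (intro continuous_at_imp_continuous_on) (auto intro: DERIV_isCont[OF W'])
  qed (use W' in auto)
  then have "w * u (a + pi / w) = w * - u a"
    using \<open>w > 0\<close> by (simp add: W_def)
  then show ?thesis
    using \<open>w > 0\<close> by (simp only: mult_cancel_left) simp
qed

lemma no_positive_harmonic_oscillator:
  assumes u: "production_function u" and "c > 0"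
    and eq: "\<And>x. x > 0 \<Longrightarrow> deriv (deriv u) x = - c * u x"
  shows False
proof -
  define w where "w = sqrt c"
  have w: "w > 0" "w\<^sup>2 = c" using \<open>c > 0\<close> by (auto simp: w_def)
  have "u (1 + pi / w) = - u 1"
  proof (rule harmonic_oscillator_antiperiodic[OF w(1)])
    fix t :: real assume "t \<ge> 1"
    then have t: "t > 0" by simp
    show "(u has_real_derivative deriv u t) (at t)"
      by (rule production_function_derivatives(3)[OF u t])
    show "(deriv u has_real_derivative - w\<^sup>2 * u t) (at t)"
      using production_function_derivatives(4)[OF u t] by (simp add: eq[OF t] w(2))
  qed
  moreover have "1 + pi / w > 0" using w(1) by (simp add: add_pos_pos)
  then have "u (1 + pi / w) > 0" "u 1 > 0"
    using production_function_derivatives(1)[OF u] by auto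
  ultimately show False by simp
qed

text \<open>
  A vanishing second derivative gives an affine function of nonzero slope, and a negative slope
  would force negative values for large arguments.
\<close>

lemma production_function_second_deriv_zero:
  assumes u: "production_function u"
    and zero: "\<And>x. x > 0 \<Longrightarrow> deriv (deriv u) x = 0"
  shows "\<exists>p d. p > 0 \<and> (\<forall>x>0. u x = p * (x + d))"
proof -
  note D = production_function_derivatives[OF u]
  define p where "p = deriv u 1"
  have slope: "deriv u x = p" if "x > 0" for x
    unfolding p_def
  proof (rule has_field_derivative_zero_constant[of "{0<..}" "deriv u", THEN exE])
    fix t :: real assume "t \<in> {0<..}"
    then show "(deriv u has_field_derivative 0) (at t within {0<..})"
      using D(4)[of t] zero[of t] by (auto intro: has_field_derivative_at_within)
  next
    fix k assume "\<forall>t\<in>{0<..}. deriv u t = k"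
    then show "deriv u x = deriv u 1" using that by auto
  qed simp
  have "((\<lambda>t. u t - p * t) has_real_derivative 0) (at t within {0<..})" if "t \<in> {0<..}" for t
    using D(3)[of t] slope[of t] that
    by (auto intro!: derivative_eq_intros intro: has_field_derivative_at_within)
  then obtain q where "\<forall>t\<in>{0<..}. u t - p * t = q"
    using has_field_derivative_zero_constant[of "{0<..}" "\<lambda>t. u t - p * t"] by auto
  then have affine: "u x = p * x + q" if "x > 0" for x
    using that by (simp add: algebra_simps)
  have "p \<noteq> 0" using D(2)[of 1] by (simp add: p_def)
  moreover have "\<not> p < 0"
  proof
    assume "p < 0"
    (* Here p * x = - (\<bar>q\<bar> + 1), which outweighs q. *)
    define x where "x = (\<bar>q\<bar> + 1) / (- p)"
    have "x > 0" using \<open>p < 0\<close> unfolding x_def by (intro divide_pos_pos) auto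
    moreover have "p * x = - (\<bar>q\<bar> + 1)" using \<open>p < 0\<close> by (simp add: x_def)
    ultimately show False using affine[of x] D(1)[of x] by linarith
  qed
  ultimately have "p > 0" by simp
  moreover have "u x = p * (x + q / p)" if "x > 0" for x
    using affine[OF that] \<open>p > 0\<close> by (simp add: field_simps)
  ultimately show ?thesis by blast
qed

theorem theorem3p2:
  fixes f g :: "real \<Rightarrow> real" and h :: "real \<Rightarrow> real \<Rightarrow> real" and H\<^sub>0 :: real
  assumes "production_function f"
    and "production_function g"
    and "\<forall>x>0. \<forall>y>0. h x y = f x * g y"
    and "\<forall>x>0. \<forall>y>0. isotropic_mean_curvature h x y = H\<^sub>0"
  shows "((\<exists>g\<^sub>0 d\<^sub>1 d\<^sub>2. g\<^sub>0 \<noteq> 0 \<and> (\<forall>x>0. \<forall>y>0. h x y = H\<^sub>0 / g\<^sub>0 * x\<^sup>2 + d\<^sub>1 * x + d\<^sub>2)) \<or>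
          (\<exists>f\<^sub>0 d\<^sub>1 d\<^sub>2. f\<^sub>0 \<noteq> 0 \<and> (\<forall>x>0. \<forall>y>0. h x y = H\<^sub>0 / f\<^sub>0 * y\<^sup>2 + d\<^sub>1 * y + d\<^sub>2))) \<or>
         (isotropic_minimal h \<and> H\<^sub>0 = 0 \<and>
          (\<exists>A d\<^sub>1 d\<^sub>2. A > 0 \<and> (\<forall>x>0. \<forall>y>0. h x y = A * (x + d\<^sub>1) * (y + d\<^sub>2))))"
proof -
  note F = production_function_derivatives[OF assms(1)]
  note G = production_function_derivatives[OF assms(2)]
  have eq: "deriv (deriv f) x * g y + f x * deriv (deriv g) y = H\<^sub>0" if "x > 0" "y > 0" for x y
    using isotropic_mean_curvature_product[OF assms(1-3) that] assms(4) that by simp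
  obtain l where l: "\<And>y. y > 0 \<Longrightarrow> deriv (deriv g) y = l * g y"
    using separation_constant_exists[where g = g, OF eq zero_less_one F(3,5,2)[OF zero_less_one]]
    by auto
  have eq': "deriv (deriv g) y * f x + g y * deriv (deriv f) x = H\<^sub>0" if "y > 0" "x > 0" for x y
    using eq[OF that(2,1)] by (simp add: mult.commute add.commute)
  obtain k where k: "\<And>x. x > 0 \<Longrightarrow> deriv (deriv f) x = k * f x"
    using separation_constant_exists[where g = f, OF eq' zero_less_one G(3,5,2)[OF zero_less_one]]
    by auto
  have eq'': "(k + l) * g 1 * f x = H\<^sub>0" if "x > 0" for x
    using eq[OF that, of 1] k[OF that] l[of 1] by (simp add: algebra_simps)
  have "(k + l) * g 1 * deriv f 1 = 0"
  proof (rule DERIV_unique)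
    show "((\<lambda>x. (k + l) * g 1 * f x) has_real_derivative (k + l) * g 1 * deriv f 1) (at 1)"
      by (intro DERIV_cmult F(3)) simp
    show "((\<lambda>x. (k + l) * g 1 * f x) has_real_derivative 0) (at 1)"
      by (rule DERIV_zero_of_const_on_pos[OF zero_less_one eq''])
  qed
  then have kl: "l = - k" using F(2)[of 1] G(1)[of 1] by auto
  then have H0: "H\<^sub>0 = 0" using eq''[of 1] by simp
  have "\<not> k < 0"
    using no_positive_harmonic_oscillator[OF assms(1), of "- k"] k by auto
  moreover have "\<not> k > 0"
    using no_positive_harmonic_oscillator[OF assms(2), of k] l kl by auto
  ultimately have "k = 0" by simp
  obtain p d where f: "p > 0" "\<And>x. x > 0 \<Longrightarrow> f x = p * (x + d)"
    using production_function_second_deriv_zero[OF assms(1)] k \<open>k = 0\<close> by auto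
  obtain r e where g: "r > 0" "\<And>y. y > 0 \<Longrightarrow> g y = r * (y + e)"
    using production_function_second_deriv_zero[OF assms(2)] l kl \<open>k = 0\<close> by auto
  have "p * r > 0" using f(1) g(1) by simp
  moreover have "\<forall>x>0. \<forall>y>0. h x y = (p * r) * (x + d) * (y + e)"
    using assms(3) f(2) g(2) by (simp add: algebra_simps)
  moreover have "isotropic_minimal h"
    using assms(4) H0 unfolding isotropic_minimal_def by simp
  ultimately show ?thesis using H0 by blast
qed

end
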